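(* For every formal weight enumerator $W(x,y)=x^n+\sum_{i=d}^n A_i x^{n-i} y^i$ (with $A_d\ne 0$) of Types I through IV, we have: (Type I) $d\leq 2\left[ \frac{n-4}{8} \right] +2$; (Type II) $d\leq 4\left[ \frac{n-12}{24} \right] +4$; (Type III) $d\leq 3\left[ \frac{n-6}{12} \right] +3$; (Type IV) $d\leq 2\left[ \frac{n-3}{6} \right] +2$, where $[x]$ denotes the greatest integer not exceeding $x\in\mathbf{R}$.
   Context: Consider homogeneous polynomials of the form $W(x,y)=x^n+\sum_{i=d}^n A_i x^{n-i} y^i\in \mathbf{C}[x,y]$ with $A_d\ne 0$. For a linear transformation $\sigma=\begin{pmatrix} a & b \\ c & d\end{pmatrix}$, set $W^\sigma(x,y)=W(ax+by,cx+dy)$. The MacWilliams transform is $\sigma_q=\frac{1}{\sqrt{q}}\begin{pmatrix} 1 & q-1 \\ 1 & -1\end{pmatrix}$; $W$ is called a formal weight enumerator for $q$ if $W^{\sigma_q}(x,y)=-W(x,y)$. $W$ is divisible by $c$ if $A_i\ne 0$ implies $c\mid i$. Let $W_{2,q}(x,y)=x^2+(q-1)y^2$, $\varphi_4(x,y)=x^4-6x^2y^2+y^4$, $W_{\mathcal{H}_8}(x,y)=x^8+14x^4y^4+y^8$, $W_{12}(x,y)=x^{12}-33x^8y^4-33x^4y^8+y^{12}$, $W_4(x,y)=x^4+8xy^3$, $\psi_6(x,y)=x^6-20x^3y^3-8y^6$, $\varphi_3(x,y)=x^3-9xy^2$. Type I formal weight enumerators are the formal weight enumerators (for $q=2$)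 in the ring $\mathbf{C}[W_{2,2}(x,y),\varphi_4(x,y)]$; Type II are the formal weight enumerators (for $q=2$) in $\mathbf{C}[W_{\mathcal{H}_8}(x,y),W_{12}(x,y)]$; Type III are the formal weight enumerators (for $q=3$) in $\mathbf{C}[W_4(x,y),\psi_6(x,y)]$; Type IV are the formal weight enumerators (for $q=4$) in $\mathbf{C}[W_{2,4}(x,y),\varphi_3(x,y)]$. *)

theory Defs
  imports "HOL-Analysis.Analysis" "HOL-Computational_Algebra.Polynomial"
begin

text \<open>The ring \<open>\<complex>[x,y]\<close> is represented as \<open>\<complex>[x][y]\<close>: the inner variable is \<open>x\<close>, the outer
  variable is \<open>y\<close>.\<close>

type_synonym bipoly = "complex poly poly"

definition bconst :: "complex \<Rightarrow> bipoly" where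
  "bconst a = [:[:a:]:]"

definition X :: bipoly where
  "X = [:[:0, 1:]:]"

definition Y :: bipoly where
  "Y = [:0, 1:]"

text \<open>\<open>subst2 P u v\<close> is \<open>P(u,v)\<close>, the image of \<open>P\<close> under the \<open>\<complex>\<close>-algebra homomorphism with
  \<open>x \<mapsto> u\<close>, \<open>y \<mapsto> v\<close>.\<close>

definition subst2 :: "bipoly \<Rightarrow> bipoly \<Rightarrow> bipoly \<Rightarrow> bipoly" where
  "subst2 P u v = poly (map_poly (\<lambda>c. poly (map_poly bconst c) u) P) v"

definition gen_ring :: "bipoly \<Rightarrow> bipoly \<Rightarrow> bipoly set" where
  "gen_ring f g = {subst2 P f g | P. True}"

definition lin_act :: "complex^2^2 \<Rightarrow> bipoly \<Rightarrow> bipoly" where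
  "lin_act \<sigma> W = subst2 W (bconst (\<sigma>$1$1) * X + bconst (\<sigma>$1$2) * Y)
                          (bconst (\<sigma>$2$1) * X + bconst (\<sigma>$2$2) * Y)"

definition macwilliams :: "real \<Rightarrow> complex^2^2" where
  "macwilliams q = (1 / sqrt q) *\<^sub>R vector [vector [1, of_real (q - 1)], vector [1, - 1]]"

text \<open>The index range \<open>i = d, \<dots>, n\<close> makes \<open>A\<^sub>d\<close> a coefficient of the sum, so \<open>d \<le> n\<close>. The value
  \<open>d = 0\<close> is not excluded.\<close>

definition has_weight_form :: "bipoly \<Rightarrow> nat \<Rightarrow> nat \<Rightarrow> (nat \<Rightarrow> complex) \<Rightarrow> bool" where
  "has_weight_form W n d A \<longleftrightarrow>
     d \<le> n \<and> A d \<noteq> 0 \<and> W = X ^ n + (\<Sum>i=d..n. bconst (A i) * X ^ (n - i) * Y ^ i)"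

definition formal_weight_enumerator :: "real \<Rightarrow> bipoly \<Rightarrow> bool" where
  "formal_weight_enumerator q W \<longleftrightarrow>
     (\<exists>n d A. has_weight_form W n d A) \<and> lin_act (macwilliams q) W = - W"

definition W2 :: "real \<Rightarrow> bipoly" where
  "W2 q = X^2 + bconst (of_real (q - 1)) * Y^2"

definition phi4 :: bipoly where
  "phi4 = X^4 - 6 * X^2 * Y^2 + Y^4"

definition WH8 :: bipoly where
  "WH8 = X^8 + 14 * X^4 * Y^4 + Y^8"

definition W12 :: bipoly where
  "W12 = X^12 - 33 * X^8 * Y^4 - 33 * X^4 * Y^8 + Y^12"

definition W4 :: bipoly where
  "W4 = X^4 + 8 * X * Y^3"

definition psi6 :: bipoly where
  "psi6 = X^6 - 20 * X^3 * Y^3 - 8 * Y^6"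

definition phi3 :: bipoly where
  "phi3 = X^3 - 9 * X * Y^2"

definition type_I :: "bipoly \<Rightarrow> bool" where
  "type_I W \<longleftrightarrow> formal_weight_enumerator 2 W \<and> W \<in> gen_ring (W2 2) phi4"

definition type_II :: "bipoly \<Rightarrow> bool" where
  "type_II W \<longleftrightarrow> formal_weight_enumerator 2 W \<and> W \<in> gen_ring WH8 W12"

definition type_III :: "bipoly \<Rightarrow> bool" where
  "type_III W \<longleftrightarrow> formal_weight_enumerator 3 W \<and> W \<in> gen_ring W4 psi6"

definition type_IV :: "bipoly \<Rightarrow> bool" where
  "type_IV W \<longleftrightarrow> formal_weight_enumerator 4 W \<and> W \<in> gen_ring (W2 4) phi3"

end

theory Submission
  imports Defs "HOL-Computational_Algebra.Polynomial_FPS"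
begin

text \<open>Each ring is generated by an invariant \<open>f\<close> of degree \<open>a\<close> and an anti-invariant \<open>g\<close> of degree
  \<open>b\<close>, with \<open>2 b = a p\<close>. A formal weight enumerator is therefore a combination of monomials
  \<open>f\<^sup>i g\<^sup>j\<close> with \<open>a i + b j = n\<close> and \<open>j\<close> odd, and setting \<open>x = 1\<close>, \<open>t = y\<^sup>c\<close> it becomes
  \<open>R = \<Sum>\<^sub>r a\<^sub>r F\<^bsup>e + p (m - r)\<^esup> G\<^bsup>2 r + 1\<^esup>\<close> with \<open>0 \<le> r \<le> m\<close> and \<open>e < p\<close>. In all four cases
  \<open>F\<^sup>p - G\<^sup>2 = \<kappa> t (1 - t)\<^sup>c\<close>. Put \<open>u = t (1 - t)\<^sup>c / F\<^sup>p\<close>. Since \<open>R / (G F\<^bsup>e + p m\<^esup>)\<close> is a polynomial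
  of degree at most \<open>m\<close> in \<open>u\<close>, its product with \<open>u\<^bsup>- m - 2\<^esup> du\<close> is the differential of a Laurent series
  and has residue 0. This says that the coefficient of \<open>t\<^bsup>m + 1\<^esup>\<close> in
  \<open>R F\<^bsup>p - 1 - e\<^esup> (1 - t)\<^bsup>- c (m + 1) - 1\<^esup>\<close> vanishes. If \<open>d > c (m + 1)\<close>, then \<open>R = 1 + O(t\<^bsup>m + 2\<^esup>)\<close>, but
  the coefficient of \<open>t\<^bsup>m + 1\<^esup>\<close> in \<open>F\<^bsup>p - 1 - e\<^esup> (1 - t)\<^bsup>- c (m + 1) - 1\<^esup>\<close> is positive because \<open>F\<close> has
  nonnegative coefficients.\<close>

unbundle no vec_syntax
unbundle fps_syntax

section \<open>Residues of exact differentials in the ring of power series\<close>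

lemma fps_deriv_inverse_one_minus_X:
  "fps_deriv (inverse (1 - fps_X)) = (inverse (1 - fps_X) :: complex fps)\<^sup>2"
  by (subst fps_inverse_deriv) auto

lemma one_minus_X_times_inverse: "(1 - fps_X) * inverse (1 - fps_X :: complex fps) = 1"
  by (rule inverse_mult_eq_1') simp

text \<open>\<open>t d/dt\<close> multiplies the coefficient of \<open>t^j\<close> by
  \<open>j\<close>. This is the vanishing residue of the differential of the Laurent series
  \<open>w t^(-j)\<close>, stated without negative exponents.\<close>

lemma coeff_euler_operator_eq_0: "(of_nat j * w - fps_X * fps_deriv w) $ j = (0 :: complex)"
  by (cases j) (auto simp: fps_of_nat[symmetric])

text \<open>The residue of \<open>d(u\<^bsup>-j\<^esup>)\<close>, where \<open>u = t (1 - t)\<^sup>c / F\<^sup>p\<close>; the assumption on \<open>G\<close> is the formula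
  \<open>du = G (1 - t)\<^bsup>c - 1\<^esup> / F\<^bsup>p + 1\<^esup> dt\<close>.\<close>

lemma coeff_exact_differential_eq_0:
  fixes F G :: "complex fps"
  assumes G: "G = (1 - of_nat (c + 1) * fps_X) * F - of_nat p * fps_X * (1 - fps_X) * fps_deriv F"
    and "p > 0" "j > 0"
  shows "(F ^ (p * j - 1) * G * inverse (1 - fps_X) ^ (c * j + 1)) $ j = 0"
proof -
  define I :: "complex fps" where "I = inverse (1 - fps_X)"
  have I: "(1 - fps_X) * I = 1"
    unfolding I_def by (rule one_minus_X_times_inverse)
  obtain k where k: "p * j = Suc k"
    using assms by (metis nat_0_less_mult_iff gr0_implies_Suc)
  have "fps_deriv I = I\<^sup>2"
    unfolding I_def by (rule fps_deriv_inverse_one_minus_X)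
  hence dI: "fps_deriv (I ^ i) = of_nat i * I ^ (i + 1)" for i
    by (induction i) (simp_all add: power2_eq_square algebra_simps)
  have I': "I ^ (c * j) = (1 - fps_X) * I ^ (c * j + 1)"
    using I by (simp add: mult.assoc[symmetric])
  \<comment> \<open>\<open>w\<close> is \<open>u^(-j)\<close> with its pole \<open>t^(-j)\<close>
    removed.\<close>
  define w where "w = F ^ (p * j) * I ^ (c * j)"
  have dw: "fps_deriv w = of_nat p * of_nat j * fps_deriv F * F ^ k * I ^ (c * j)
      + F ^ (p * j) * (of_nat c * of_nat j * I ^ (c * j + 1))"
    unfolding w_def fps_deriv_mult dI fps_deriv_power'[of F] of_nat_mult by (simp add: k add.commute)
  \<comment> \<open>Over the common power \<open>I ^ (c * j + 1)\<close> the bracket is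
    \<open>(1 - t) F - c t F - p t (1 - t) F'\<close>, which is \<open>G\<close>.\<close>
  have "of_nat j * w - fps_X * fps_deriv w = of_nat j * (F ^ k * G * I ^ (c * j + 1))"
    unfolding dw unfolding w_def I' G k power_Suc of_nat_add by (simp add: algebra_simps)
  hence "(of_nat j * (F ^ k * G * I ^ (c * j + 1))) $ j = 0"
    using coeff_euler_operator_eq_0 by metis
  thus ?thesis
    using \<open>j > 0\<close> k by (simp add: I_def fps_of_nat[symmetric])
qed

text \<open>The factor \<open>D^s\<close> with \<open>D = F^p - G^2\<close> is there for the
  induction on \<open>r\<close>: replacing one \<open>G^2\<close> by \<open>F^p - D\<close> lowers
  \<open>r\<close> and leaves either \<open>p\<close> more factors \<open>F\<close> or one more
  factor \<open>D\<close>. At \<open>r = 0\<close> a single exact differential remains. The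
  application has \<open>s = 0\<close>.\<close>

lemma coeff_residue_eq_0:
  fixes F G :: "complex fps"
  assumes G: "G = (1 - of_nat (c + 1) * fps_X) * F - of_nat p * fps_X * (1 - fps_X) * fps_deriv F"
    and FG: "F ^ p = G\<^sup>2 + fps_const \<kappa> * fps_X * (1 - fps_X) ^ c"
    and p: "p > 0"
  shows "r + s \<le> m \<Longrightarrow> (F ^ (p - 1 + p * (m - r - s)) * G ^ (2 * r + 1) *
           (fps_const \<kappa> * fps_X * (1 - fps_X) ^ c) ^ s * inverse (1 - fps_X) ^ (c * (m + 1) + 1)) $ (m + 1) = 0"
proof (induction r arbitrary: s)
  case 0
  define I :: "complex fps" where "I = inverse (1 - fps_X)"
  \<comment> \<open>The factor \<open>t^s\<close> in \<open>D^s\<close> shifts the coefficient index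
    from \<open>m + 1\<close> to \<open>j\<close>, and \<open>(1 - t)^(c s)\<close> cancels against
    the inverse powers.\<close>
  define j where "j = m + 1 - s"
  have j: "j > 0" "m + 1 = j + s"
    using 0 by (auto simp: j_def)
  have I: "((1 - fps_X) ^ c) ^ s * I ^ (c * (m + 1) + 1) = I ^ (c * j + 1)"
  proof -
    have "I ^ (c * (m + 1) + 1) = I ^ (c * s) * I ^ (c * j + 1)"
      unfolding j(2) power_add[symmetric] by (simp add: algebra_simps)
    thus ?thesis
      using one_minus_X_times_inverse
      by (simp add: power_mult[symmetric] mult.assoc[symmetric] power_mult_distrib[symmetric] I_def)
  qed
  have e: "p - 1 + p * (m - 0 - s) = p * j - 1"
  proof -
    have "j = Suc (m - s)" using 0 by (simp add: j_def)
    thus ?thesis using p by simp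
  qed
  have "F ^ (p - 1 + p * (m - 0 - s)) * G ^ (2 * 0 + 1) *
          (fps_const \<kappa> * fps_X * (1 - fps_X) ^ c) ^ s * I ^ (c * (m + 1) + 1)
        = fps_const (\<kappa> ^ s) * (fps_X ^ s * (F ^ (p * j - 1) * G * (((1 - fps_X) ^ c) ^ s * I ^ (c * (m + 1) + 1))))"
    unfolding e by (simp add: power_mult_distrib mult_ac fps_const_power)
  also have "\<dots> $ (m + 1) = 0"
    unfolding I unfolding j(2) fps_mult_left_const_nth fps_X_power_mult_nth
    using coeff_exact_differential_eq_0[OF G p j(1)] by (simp add: I_def)
  finally show ?case by (simp add: I_def)
next
  case (Suc r)
  define I :: "complex fps" where "I = inverse (1 - fps_X) ^ (c * (m + 1) + 1)"
  define D where "D = fps_const \<kappa> * fps_X * (1 - fps_X) ^ c"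
  define q where "q = p - 1 + p * (m - Suc r - s)"
  have q: "p - 1 + p * (m - r - s) = q + p" "p - 1 + p * (m - r - Suc s) = q"
  proof -
    have "m - r - s = Suc (m - Suc r - s)" using Suc.prems by simp
    thus "p - 1 + p * (m - r - s) = q + p" by (simp add: q_def)
  qed (simp add: q_def)
  have "r + s \<le> m" "r + Suc s \<le> m"
    using Suc.prems by simp_all
  from Suc.IH[OF this(1)] Suc.IH[OF this(2)]
  have "(F ^ (q + p) * G ^ (2 * r + 1) * D ^ s * I) $ (m + 1) = 0"
    "(F ^ q * G ^ (2 * r + 1) * D ^ Suc s * I) $ (m + 1) = 0"
    unfolding q D_def I_def by blast+
  moreover have "F ^ q * G ^ (2 * Suc r + 1) * D ^ s * I
      = F ^ (q + p) * G ^ (2 * r + 1) * D ^ s * I - F ^ q * G ^ (2 * r + 1) * D ^ Suc s * I"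
    unfolding power_add[of F q p] FG D_def[symmetric] by (simp add: algebra_simps power2_eq_square)
  ultimately show ?case by (simp add: D_def I_def q_def)
qed

section \<open>A coefficient that cannot vanish\<close>

lemma sum_in_Nats:
  assumes "\<And>i. i \<in> S \<Longrightarrow> h i \<in> \<nat>"
  shows "sum h S \<in> \<nat>"
  using assms by (induction S rule: infinite_finite_induct) auto

lemma coeff_mult_Nats:
  fixes f g :: "complex fps"
  assumes "\<And>i. f $ i \<in> \<nat>" "\<And>i. g $ i \<in> \<nat>"
  shows "(f * g) $ n \<in> \<nat>"
  by (auto simp: fps_mult_nth intro!: sum_in_Nats assms Nats_mult)

lemma coeff_power_Nats:
  fixes f :: "complex fps"
  assumes "\<And>i. f $ i \<in> \<nat>"
  shows "(f ^ k) $ n \<in> \<nat>"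
  by (induction k arbitrary: n) (auto intro!: coeff_mult_Nats assms simp: fps_one_nth)

text \<open>The constant term of \<open>F ^ q\<close> contributes a positive binomial coefficient,
  and all other contributions are natural numbers. Membership in \<open>\<nat>\<close> expresses
  nonnegativity inside the complex numbers.\<close>

lemma coeff_power_mult_geometric_nonzero:
  fixes F :: "complex fps"
  assumes "\<And>i. F $ i \<in> \<nat>" "F $ 0 = 1"
  shows "(F ^ q * inverse (1 - fps_X) ^ Suc N) $ n \<noteq> 0"
proof -
  define H where "H = F ^ q"
  define B where "B = (inverse (1 - fps_X) ^ Suc N :: complex fps)"
  have B: "B $ i = of_nat ((N + i) choose i)" for i
    using one_minus_const_fps_X_neg_power'[of "Suc N" "1 :: complex"]
    by (simp add: B_def fps_inverse_power del: power_Suc)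
  have H: "H $ i \<in> \<nat>" for i
    unfolding H_def by (intro coeff_power_Nats assms)
  have H0: "H $ 0 = 1"
    by (simp add: H_def fps_nth_power_0 assms)
  have "(H * B) $ n = B $ n + (\<Sum>i=1..n. H $ i * B $ (n - i))"
    by (simp add: fps_mult_nth sum.atLeast_Suc_atMost H0)
  moreover have "(\<Sum>i=1..n. H $ i * B $ (n - i)) \<in> \<nat>"
    by (intro sum_in_Nats Nats_mult H) (simp add: B)
  then obtain l where "(\<Sum>i=1..n. H $ i * B $ (n - i)) = of_nat l"
    by (auto elim: Nats_cases)
  ultimately have "(H * B) $ n = of_nat (((N + n) choose n) + l)"
    by (simp add: B)
  moreover have "((N + n) choose n) + l \<noteq> 0" by simp
  ultimately show ?thesis unfolding H_def B_def of_nat_eq_0_iff by (metis of_nat_eq_0_iff)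
qed

text \<open>Multiplication by a fixed series \<open>T\<close> makes the coefficient of
  \<open>t^(m + 1)\<close> vanish in every summand of \<open>R\<close>, whereas the gap in
  \<open>R\<close> would make it equal to that of \<open>T\<close>, which is nonzero.\<close>

lemma combination_not_flat:
  fixes F G R :: "complex poly"
  assumes G: "G = [:1, - of_nat (c + 1):] * F - smult (of_nat p) ([:0, 1, -1:] * pderiv F)"
    and FG: "F ^ p = G\<^sup>2 + smult \<kappa> ([:0, 1:] * [:1, -1:] ^ c)"
    and F: "\<And>i. coeff F i \<in> \<nat>" "coeff F 0 = 1"
    and e: "e < p"
    and R: "R = (\<Sum>x\<in>S. smult (a x) (F ^ (e + p * (m - r x)) * G ^ (2 * r x + 1)))"
    and r: "\<And>x. x \<in> S \<Longrightarrow> r x \<le> m"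
    and R0: "coeff R 0 = 1" and R1: "\<And>i. 0 < i \<Longrightarrow> i \<le> m + 1 \<Longrightarrow> coeff R i = 0"
  shows False
proof -
  have p: "p > 0" using e by simp
  define F' where "F' = fps_of_poly F"
  define G' where "G' = fps_of_poly G"
  define E where "E = (1 - fps_X :: complex fps)"
  have lin: "fps_of_poly [:1, -1:] = E"
    by (simp add: E_def fps_of_poly_pCons)
  have G': "G' = (1 - of_nat (c + 1) * fps_X) * F' - of_nat p * fps_X * (1 - fps_X) * fps_deriv F'"
  proof -
    have "fps_of_poly [:1, - of_nat (c + 1) :: complex:] = 1 - of_nat (c + 1) * fps_X"
      by (simp add: fps_of_poly_pCons fps_of_nat[symmetric] fps_const_neg[symmetric] del: fps_const_neg)
    moreover have "fps_of_poly [:0, 1, -1 :: complex:] = fps_X * (1 - fps_X)"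
      by (simp add: fps_of_poly_pCons algebra_simps)
    ultimately show ?thesis
      unfolding G'_def F'_def G fps_of_poly_diff fps_of_poly_mult fps_of_poly_smult fps_of_poly_pderiv
      by (simp add: fps_of_nat mult_ac)
  qed
  have FG': "F' ^ p = G'\<^sup>2 + fps_const \<kappa> * fps_X * (1 - fps_X) ^ c"
  proof -
    have "fps_of_poly (F ^ p) = fps_of_poly (G\<^sup>2 + smult \<kappa> ([:0, 1:] * [:1, -1:] ^ c))"
      using FG by simp
    thus ?thesis
      by (simp add: F'_def G'_def fps_of_poly_add fps_of_poly_mult fps_of_poly_smult fps_of_poly_power lin
          E_def[symmetric] mult_ac del: mult_pCons_left)
  qed
  define I where "I = inverse (1 - fps_X :: complex fps) ^ (c * (m + 1) + 1)"
  \<comment> \<open>The power of \<open>F\<close> raises the exponent \<open>e\<close> to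
    \<open>p - 1\<close>, the one for which the residue vanishes.\<close>
  define T where "T = F' ^ (p - 1 - e) * I"
  have term0: "(fps_of_poly (smult (a x) (F ^ (e + p * (m - r x)) * G ^ (2 * r x + 1))) * T) $ (m + 1) = 0"
    if "x \<in> S" for x
  proof -
    have "p - 1 + p * (m - r x) = (e + p * (m - r x)) + (p - 1 - e)" using e by simp
    hence "F' ^ (p - 1 + p * (m - r x)) = F' ^ (e + p * (m - r x)) * F' ^ (p - 1 - e)"
      by (metis power_add)
    hence "fps_of_poly (smult (a x) (F ^ (e + p * (m - r x)) * G ^ (2 * r x + 1))) * T
          = fps_const (a x) * (F' ^ (p - 1 + p * (m - r x)) * G' ^ (2 * r x + 1) * I)"
      by (simp add: T_def F'_def G'_def fps_of_poly_smult fps_of_poly_mult fps_of_poly_power mult_ac)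
    also have "\<dots> $ (m + 1) = 0"
      using coeff_residue_eq_0[OF G' FG' p, of "r x" 0 m] r[OF that]
      by (simp add: I_def del: power_Suc)
    finally show ?thesis .
  qed
  have "(fps_of_poly R * T) $ (m + 1) = 0"
    unfolding R fps_of_poly_sum sum_distrib_right fps_sum_nth by (intro sum.neutral ballI term0)
  moreover have "(fps_of_poly R * T) $ (m + 1) = T $ (m + 1)"
  proof -
    have "(fps_of_poly R * T) $ (m + 1) = (\<Sum>i=0..m+1. if i = 0 then T $ (m + 1) else 0)"
      unfolding fps_mult_nth using R0 R1 by (intro sum.cong) auto
    thus ?thesis by simp
  qed
  moreover have "T $ (m + 1) \<noteq> 0"
    unfolding T_def I_def using coeff_power_mult_geometric_nonzero[of F'] F by (simp add: F'_def)
  ultimately show False by simp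
qed

section \<open>Values of bivariate polynomials at complex points\<close>

definition ev :: "bipoly \<Rightarrow> complex \<Rightarrow> complex \<Rightarrow> complex" where
  "ev W x y = poly (poly W [:y:]) x"

lemma ev_simps [simp]:
  "ev (P + Q) x y = ev P x y + ev Q x y"
  "ev (P - Q) x y = ev P x y - ev Q x y"
  "ev (P * Q) x y = ev P x y * ev Q x y"
  "ev (- P) x y = - ev P x y"
  "ev (P ^ k) x y = ev P x y ^ k"
  "ev (numeral l) x y = numeral l"
  "ev 1 x y = 1" "ev 0 x y = 0"
  "ev X x y = x" "ev Y x y = y" "ev (bconst a) x y = a"
  "ev (sum h S) x y = (\<Sum>i\<in>S. ev (h i) x y)"
  by (simp_all add: ev_def X_def Y_def bconst_def poly_sum)

lemma ev_expand: "ev P u v = (\<Sum>j\<le>degree P. \<Sum>i\<le>degree (coeff P j). coeff (coeff P j) i * u ^ i * v ^ j)"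
proof -
  have "ev P u v = (\<Sum>j\<le>degree P. poly (coeff P j) u * v ^ j)"
    by (simp add: ev_def poly_altdef[of P] poly_sum)
  thus ?thesis
    by (simp add: poly_altdef sum_distrib_right)
qed


lemma ev_poly_map_poly:
  assumes "\<phi> 0 = 0"
  shows "ev (poly (map_poly \<phi> p) v) x y = poly (map_poly (\<lambda>c. ev (\<phi> c) x y) p) (ev v x y)"
  using assms by (induction p) (simp_all add: map_poly_pCons)

lemma ev_subst2: "ev (subst2 P u v) x y = ev P (ev u x y) (ev v x y)"
proof -
  have b: "bconst 0 = 0" by (simp add: bconst_def)
  have "ev (subst2 P u v) x y = poly (map_poly (\<lambda>c. poly c (ev u x y)) P) (ev v x y)"
    by (simp add: subst2_def ev_poly_map_poly b map_poly_idI)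
  also have "\<dots> = ev P (ev u x y) (ev v x y)"
    unfolding ev_def by (induction P) (simp_all add: map_poly_pCons)
  finally show ?thesis .
qed


text \<open>Used to read off the coefficients of \<open>R(t)\<close> from
  \<open>R(y^c) = W(1, y)\<close>.\<close>

lemma coeff_pcompose_monom:
  fixes P :: "complex poly"
  assumes "c > 0"
  shows "coeff (pcompose P (monom 1 c)) (c * s) = coeff P s"
proof (induction P arbitrary: s)
  case (pCons a P)
  show ?case
  proof (cases s)
    case 0
    thus ?thesis using assms by (simp add: pcompose_pCons coeff_mult_0 coeff_monom)
  next
    case (Suc k)
    thus ?thesis using assms pCons.IH[of k]
      by (simp add: pcompose_pCons coeff_monom_mult coeff_pCons split: nat.split)
  qed
qed simp

section \<open>Homogeneous and anti-invariant components, and the general bound\<close>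

lemma ev_weight_form:
  assumes "has_weight_form W n d A"
  shows "ev W x y = x ^ n + (\<Sum>i=d..n. A i * x ^ (n - i) * y ^ i)"
  using assms by (simp add: has_weight_form_def)

lemma ev_weight_form_homogeneous:
  assumes "has_weight_form W n d A"
  shows "ev W (s * x) (s * y) = s ^ n * ev W x y"
proof -
  have "A i * (s * x) ^ (n - i) * (s * y) ^ i = s ^ n * (A i * x ^ (n - i) * y ^ i)" if "i \<in> {d..n}" for i
  proof -
    have "s ^ n = s ^ (n - i) * s ^ i" using that by (simp add: power_add[symmetric])
    thus ?thesis by (simp add: power_mult_distrib)
  qed
  hence "(\<Sum>i=d..n. A i * (s * x) ^ (n - i) * (s * y) ^ i) = (\<Sum>i=d..n. s ^ n * (A i * x ^ (n - i) * y ^ i))"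
    by (rule sum.cong[OF refl])
  thus ?thesis
    unfolding ev_weight_form[OF assms] by (simp add: power_mult_distrib distrib_left sum_distrib_left)
qed

text \<open>Both sides are polynomials in \<open>s\<close> agreeing everywhere, so their
  coefficients of \<open>s^n\<close> agree.\<close>

lemma weighted_component:
  assumes "finite S" "\<And>s. (\<Sum>x\<in>S. h x * s ^ k x) = s ^ n * (w :: complex)"
  shows "w = (\<Sum>x | x \<in> S \<and> k x = n. h x)"
proof -
  have "(\<Sum>x\<in>S. monom (h x) (k x)) = monom w n"
    by (subst poly_eq_poly_eq_iff[symmetric]) (auto simp: poly_sum poly_monom assms mult.commute)
  hence "w = coeff (\<Sum>x\<in>S. monom (h x) (k x)) n" by simp
  also have "\<dots> = (\<Sum>x\<in>S. if k x = n then h x else 0)"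
    by (simp add: coeff_sum coeff_monom)
  also have "\<dots> = (\<Sum>x | x \<in> S \<and> k x = n. h x)"
    by (rule sum.mono_neutral_cong_right) (use assms in auto)
  finally show ?thesis .
qed

text \<open>Two projections applied to any representation of \<open>W\<close>: scaling
  \<open>(x, y)\<close> by \<open>s\<close> selects the monomials of degree \<open>n\<close>, and
  then \<open>2 W = W - W(T, U)\<close> cancels the even powers of \<open>g\<close> and doubles the
  odd ones.\<close>

lemma anti_invariant_combination:
  assumes W: "W \<in> gen_ring f g"
    and homW: "\<And>s x y. ev W (s * x) (s * y) = s ^ n * ev W x y"
    and homf: "\<And>s x y. ev f (s * x) (s * y) = s ^ a * ev f x y"
    and homg: "\<And>s x y. ev g (s * x) (s * y) = s ^ b * ev g x y"
    and inv: "\<And>x y. ev W (T x y) (U x y) = - ev W x y"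
      "\<And>x y. ev f (T x y) (U x y) = ev f x y" "\<And>x y. ev g (T x y) (U x y) = - ev g x y"
  obtains S and q :: "nat \<times> nat \<Rightarrow> complex" where "finite S"
    "\<And>i j. (i, j) \<in> S \<Longrightarrow> a * i + b * j = n \<and> odd j"
    "\<And>x y. ev W x y = (\<Sum>(i, j)\<in>S. q (i, j) * (ev f x y ^ i * ev g x y ^ j))"
proof -
  obtain P where P: "W = subst2 P f g" using W by (auto simp: gen_ring_def)
  define q where "q = (\<lambda>(i, j). coeff (coeff P j) i)"
  define S0 where "S0 = prod.swap ` (SIGMA j:{..degree P}. {..degree (coeff P j)})"
  have fin: "finite S0" by (simp add: S0_def)
  have P_eq: "ev P u v = (\<Sum>(i, j)\<in>S0. q (i, j) * (u ^ i * v ^ j))" for u v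
    unfolding ev_expand S0_def q_def
    by (subst sum.reindex) (auto simp: sum.Sigma case_prod_unfold mult_ac)
  define S1 where "S1 = {x \<in> S0. a * fst x + b * snd x = n}"
  define S where "S = {x \<in> S1. odd (snd x)}"
  have S1: "ev W x y = (\<Sum>(i, j)\<in>S1. q (i, j) * (ev f x y ^ i * ev g x y ^ j))" for x y
  proof -
    have "(\<Sum>z\<in>S0. q z * (ev f x y ^ fst z * ev g x y ^ snd z) * s ^ (a * fst z + b * snd z)) = s ^ n * ev W x y" for s
      using homW[of s x y] unfolding P ev_subst2 P_eq homf homg
      by (simp add: power_mult_distrib power_mult power_add case_prod_unfold mult_ac)
    from weighted_component[OF fin this] show ?thesis
      by (simp add: S1_def case_prod_unfold)
  qed
  have "ev W x y = (\<Sum>(i, j)\<in>S. q (i, j) * (ev f x y ^ i * ev g x y ^ j))" for x y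
  proof -
    have "2 * ev W x y = ev W x y - ev W (T x y) (U x y)" by (simp add: inv)
    also have "\<dots> = (\<Sum>(i, j)\<in>S1. q (i, j) * (ev f x y ^ i * ev g x y ^ j) - q (i, j) * (ev f x y ^ i * (- ev g x y) ^ j))"
      by (simp only: S1 inv sum_subtractf case_prod_unfold)
    also have "\<dots> = (\<Sum>(i, j)\<in>S. 2 * (q (i, j) * (ev f x y ^ i * ev g x y ^ j)))"
      by (rule sum.mono_neutral_cong_right) (auto simp: S_def S1_def fin)
    finally show ?thesis by (simp add: sum_distrib_left[symmetric] case_prod_unfold)
  qed
  moreover have "finite S" "\<And>i j. (i, j) \<in> S \<Longrightarrow> a * i + b * j = n \<and> odd j"
    using fin by (simp_all add: S_def S1_def)
  ultimately show ?thesis by (intro that)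
qed

text \<open>The argument common to the four types. Since \<open>a p = 2 b\<close>, each monomial
  \<open>f^i g^j\<close> with \<open>j\<close> odd has \<open>n - b = a (i + p (j div 2))\<close>;
  dividing the bracket by \<open>p\<close> with remainder gives the \<open>m\<close> and
  \<open>e\<close> of the power series argument, and \<open>m\<close> is the floor in the
  bound.\<close>

lemma minimum_distance_bound:
  fixes F G :: "complex poly"
  assumes form: "has_weight_form W n d A" and W: "W \<in> gen_ring f g"
    and homf: "\<And>s x y. ev f (s * x) (s * y) = s ^ a * ev f x y"
    and homg: "\<And>s x y. ev g (s * x) (s * y) = s ^ b * ev g x y"
    and inv: "\<And>x y. ev W (T x y) (U x y) = - ev W x y"
      "\<And>x y. ev f (T x y) (U x y) = ev f x y" "\<And>x y. ev g (T x y) (U x y) = - ev g x y"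
    and fg: "\<And>y. ev f 1 y = poly F (y ^ c)" "\<And>y. ev g 1 y = poly G (y ^ c)"
    and pos: "a > 0" "b > 0" "c > 0" and ap: "a * p = 2 * b"
    and G: "G = [:1, - of_nat (c + 1):] * F - smult (of_nat p) ([:0, 1, -1:] * pderiv F)"
    and FG: "F ^ p = G\<^sup>2 + smult \<kappa> ([:0, 1:] * [:1, -1:] ^ c)"
    and F: "\<And>i. coeff F i \<in> \<nat>" "coeff F 0 = 1"
  shows "int d \<le> int c * \<lfloor>(real n - real b) / real (2 * b)\<rfloor> + int c"
proof (cases "d = 0")
  \<comment> \<open>Here \<open>W(1, 0)\<close> is \<open>1 + A 0\<close> instead of 1, so the case
    is settled directly: the floor is at least -1 and the bound is nonnegative.\<close>
  case True
  have "- 1 \<le> (real n - real b) / real (2 * b)" using pos by (simp add: field_simps)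
  hence "- 1 \<le> \<lfloor>(real n - real b) / real (2 * b)\<rfloor>" by (subst le_floor_iff) simp
  hence "int c * (- 1) \<le> int c * \<lfloor>(real n - real b) / real (2 * b)\<rfloor>"
    by (intro mult_left_mono) auto
  thus ?thesis using True by simp
next
  case False
  obtain S and q :: "nat \<times> nat \<Rightarrow> complex" where fin: "finite S"
    and S: "\<And>i j. (i, j) \<in> S \<Longrightarrow> a * i + b * j = n \<and> odd j"
    and W_eq: "\<And>x y. ev W x y = (\<Sum>(i, j)\<in>S. q (i, j) * (ev f x y ^ i * ev g x y ^ j))"
    by (fact anti_invariant_combination[OF W ev_weight_form_homogeneous[OF form] homf homg inv])
  \<comment> \<open>A nonzero value rules out the empty combination, so some monomial is available
    to define \<open>N\<close>.\<close>
  have "ev W 1 0 = 1"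
    using False by (simp add: ev_weight_form[OF form] power_0_left)
  hence "S \<noteq> {}" using W_eq[of 1 0] by auto
  then obtain i0 j0 where 0: "(i0, j0) \<in> S" by auto
  define N where "N = i0 + p * (j0 div 2)"
  have n: "n = b + a * (i + p * (j div 2))" if ij: "(i, j) \<in> S" for i j
  proof -
    obtain l where j: "j = 2 * l + 1" using S[OF ij] oddE by blast
    have "b * (2 * l) = a * p * l" unfolding ap by simp
    hence "b * j = b + a * p * l" by (simp only: j distrib_left)
    hence "n = b + (a * i + a * p * l)" using S[OF ij] by linarith
    moreover have "j div 2 = l" using j by simp
    ultimately show ?thesis by (simp only: distrib_left mult.assoc)
  qed
  have p: "p > 0" using ap pos by (cases p) auto
  define m where "m = N div p"
  define e where "e = N mod p"
  have e: "e < p" using p by (simp add: e_def)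
  have N: "i + p * (j div 2) = N" if "(i, j) \<in> S" for i j
    using n[OF that] n[OF 0] pos by (simp add: N_def)
  have jm: "j div 2 \<le> m" if "(i, j) \<in> S" for i j
    using N[OF that] p by (metis le_add2 m_def div_le_mono nonzero_mult_div_cancel_left not_gr_zero)
  have i: "i = e + p * (m - j div 2)" if "(i, j) \<in> S" for i j
  proof -
    have "i + p * (j div 2) = e + p * m" using N[OF that] by (simp add: e_def m_def)
    also have "\<dots> = e + p * (m - j div 2) + p * (j div 2)"
      using jm[OF that] by (simp add: add.assoc distrib_left[symmetric])
    finally show ?thesis by simp
  qed
  have "(real n - real b) / real (2 * b) = real N / real p"
  proof -
    have "real n - real b = real a * real N" using n[OF 0] by (simp add: N_def)
    moreover have "real (2 * b) = real a * real p" using ap by (metis of_nat_mult)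
    ultimately show ?thesis using pos by simp
  qed
  hence floor: "\<lfloor>(real n - real b) / real (2 * b)\<rfloor> = int m"
    by (simp add: m_def floor_divide_of_nat_eq)
  define R where "R = (\<Sum>x\<in>S. smult (q x) (F ^ (e + p * (m - snd x div 2)) * G ^ (2 * (snd x div 2) + 1)))"
  have "poly R (y ^ c) = 1 + (\<Sum>i=d..n. A i * y ^ i)" for y
  proof -
    have "poly R (y ^ c) = (\<Sum>(i, j)\<in>S. q (i, j) * (ev f 1 y ^ i * ev g 1 y ^ j))"
      unfolding R_def poly_sum
    proof (intro sum.cong refl, clarify)
      fix i j assume ij: "(i, j) \<in> S"
      have "2 * (j div 2) + 1 = j" using S[OF ij] by simp
      thus "poly (smult (q (i, j)) (F ^ (e + p * (m - snd (i, j) div 2)) * G ^ (2 * (snd (i, j) div 2) + 1))) (y ^ c)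
        = q (i, j) * (ev f 1 y ^ i * ev g 1 y ^ j)"
        unfolding snd_conv i[OF ij, symmetric] by (simp add: fg)
    qed
    thus ?thesis using W_eq[of 1 y] ev_weight_form[OF form, of 1 y] by simp
  qed
  hence "pcompose R (monom 1 c) = 1 + (\<Sum>i=d..n. monom (A i) i)"
    by (subst poly_eq_poly_eq_iff[symmetric]) (auto simp: poly_pcompose poly_monom poly_sum)
  hence R_coeff: "coeff R s = coeff (1 + (\<Sum>i=d..n. monom (A i) i)) (c * s)" for s
    using coeff_pcompose_monom[OF pos(3)] by metis
  \<comment> \<open>Below \<open>d\<close> only the leading 1 of the weight form
    contributes.\<close>
  have low: "coeff R s = (if s = 0 then 1 else 0)" if "c * s < d" for s
    using that pos unfolding R_coeff by (auto simp: coeff_sum coeff_monom intro!: sum.neutral)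
  have "d \<le> c * (m + 1)"
  proof (rule ccontr)
    assume "\<not> d \<le> c * (m + 1)"
    hence "c * s < d" if "s \<le> m + 1" for s
      using that by (meson le_less_trans mult_le_mono2 not_le)
    thus False
      using combination_not_flat[OF G FG F e R_def] jm low False by force
  qed
  hence "int d \<le> int (c * (m + 1))" by linarith
  thus ?thesis unfolding floor by (simp add: algebra_simps)
qed


section \<open>The MacWilliams transform on the generators\<close>

lemma ev_lin_act_macwilliams:
  "ev (lin_act (macwilliams q) W) x y =
     ev W (of_real (1 / sqrt q) * (x + of_real (q - 1) * y)) (of_real (1 / sqrt q) * (x - y))"
  by (simp add: lin_act_def ev_subst2 macwilliams_def scaleR_conv_of_real[where 'a = complex] algebra_simps
      add_divide_distrib diff_divide_distrib)

lemma formal_weight_enumerator_anti_invariant: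
  assumes "formal_weight_enumerator q W"
  shows "ev W (of_real (1 / sqrt q) * (x + of_real (q - 1) * y)) (of_real (1 / sqrt q) * (x - y)) = - ev W x y"
  using assms unfolding formal_weight_enumerator_def ev_lin_act_macwilliams[symmetric] by simp

text \<open>For generators of even degree, homogeneity pulls the scalar out in an even power, which
  is rational; the remaining identity is left to \<open>algebra\<close>.\<close>

lemma inv_sqrt_power:
  assumes "q > 0"
  shows "complex_of_real (1 / sqrt q) ^ (2 * k) = 1 / of_real q ^ k"
proof -
  have "complex_of_real (1 / sqrt q) ^ 2 = of_real ((1 / sqrt q) ^ 2)" by (rule of_real_power[symmetric])
  also have "\<dots> = 1 / of_real q" using assms by (simp add: power_divide)
  finally show ?thesis by (simp only: power_mult power_one_over)
qed

lemma ev_homogeneous: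
  "ev (W2 q) (s * x) (s * y) = s ^ 2 * ev (W2 q) x y"
  "ev phi4 (s * x) (s * y) = s ^ 4 * ev phi4 x y"
  "ev WH8 (s * x) (s * y) = s ^ 8 * ev WH8 x y"
  "ev W12 (s * x) (s * y) = s ^ 12 * ev W12 x y"
  "ev W4 (s * x) (s * y) = s ^ 4 * ev W4 x y"
  "ev psi6 (s * x) (s * y) = s ^ 6 * ev psi6 x y"
  "ev phi3 (s * x) (s * y) = s ^ 3 * ev phi3 x y"
  by (simp_all add: W2_def phi4_def WH8_def W12_def W4_def psi6_def phi3_def power_mult_distrib, algebra+)

lemma macwilliams_2:
  fixes x y :: complex
  defines "h \<equiv> of_real (1 / sqrt 2)"
  shows "ev (W2 2) (h * (x + of_real (2 - 1) * y)) (h * (x - y)) = ev (W2 2) x y"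
    "ev phi4 (h * (x + of_real (2 - 1) * y)) (h * (x - y)) = - ev phi4 x y"
    "ev WH8 (h * (x + of_real (2 - 1) * y)) (h * (x - y)) = ev WH8 x y"
    "ev W12 (h * (x + of_real (2 - 1) * y)) (h * (x - y)) = - ev W12 x y"
proof -
  note h = inv_sqrt_power[of 2, folded h_def]
  have "h ^ 2 = 1 / 2" "h ^ 4 = 1 / 4" "h ^ 8 = 1 / 16" "h ^ 12 = 1 / 64"
    using h[of 1] h[of 2] h[of 4] h[of 6] by simp_all
  note this [simp]
  show "ev (W2 2) (h * (x + of_real (2 - 1) * y)) (h * (x - y)) = ev (W2 2) x y"
    unfolding ev_homogeneous by (simp add: W2_def) algebra
  show "ev phi4 (h * (x + of_real (2 - 1) * y)) (h * (x - y)) = - ev phi4 x y"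
    unfolding ev_homogeneous by (simp add: phi4_def) algebra
  show "ev WH8 (h * (x + of_real (2 - 1) * y)) (h * (x - y)) = ev WH8 x y"
    unfolding ev_homogeneous by (simp add: WH8_def) algebra
  show "ev W12 (h * (x + of_real (2 - 1) * y)) (h * (x - y)) = - ev W12 x y"
    unfolding ev_homogeneous by (simp add: W12_def) algebra
qed

lemma macwilliams_3:
  fixes x y :: complex
  defines "h \<equiv> of_real (1 / sqrt 3)"
  shows "ev W4 (h * (x + of_real (3 - 1) * y)) (h * (x - y)) = ev W4 x y"
    "ev psi6 (h * (x + of_real (3 - 1) * y)) (h * (x - y)) = - ev psi6 x y"
proof -
  note h = inv_sqrt_power[of 3, folded h_def]
  have "h ^ 4 = 1 / 9" "h ^ 6 = 1 / 27"
    using h[of 2] h[of 3] by simp_all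
  note this [simp]
  show "ev W4 (h * (x + of_real (3 - 1) * y)) (h * (x - y)) = ev W4 x y"
    unfolding ev_homogeneous by (simp add: W4_def) algebra
  show "ev psi6 (h * (x + of_real (3 - 1) * y)) (h * (x - y)) = - ev psi6 x y"
    unfolding ev_homogeneous by (simp add: psi6_def) algebra
qed

lemma macwilliams_4:
  fixes x y :: complex
  defines "h \<equiv> of_real (1 / sqrt 4)"
  shows "ev (W2 4) (h * (x + of_real (4 - 1) * y)) (h * (x - y)) = ev (W2 4) x y"
    "ev phi3 (h * (x + of_real (4 - 1) * y)) (h * (x - y)) = - ev phi3 x y"
proof -
  \<comment> \<open>\<open>phi3\<close> has odd degree, so the value of the scalar itself is
    used.\<close>
  have "sqrt 4 = 2" by (rule real_sqrt_unique) auto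
  hence [simp]: "h = 1 / 2" by (simp add: h_def)
  show "ev (W2 4) (h * (x + of_real (4 - 1) * y)) (h * (x - y)) = ev (W2 4) x y"
    unfolding ev_homogeneous by (simp add: W2_def power_divide) algebra
  show "ev phi3 (h * (x + of_real (4 - 1) * y)) (h * (x - y)) = - ev phi3 x y"
    unfolding ev_homogeneous by (simp add: phi3_def power_divide) algebra
qed

section \<open>The four types\<close>

lemma coeff_pCons_Nats:
  "coeff (pCons (a :: complex) P) i \<in> \<nat> \<longleftrightarrow> (case i of 0 \<Rightarrow> a \<in> \<nat> | Suc j \<Rightarrow> coeff P j \<in> \<nat>)"
  by (cases i) simp_all

theorem theorem1p1:
  fixes W :: bipoly and n d :: nat and A :: "nat \<Rightarrow> complex"
  assumes "has_weight_form W n d A"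
  shows "(type_I W \<longrightarrow> int d \<le> 2 * \<lfloor>(real n - 4) / 8\<rfloor> + 2) \<and>
         (type_II W \<longrightarrow> int d \<le> 4 * \<lfloor>(real n - 12) / 24\<rfloor> + 4) \<and>
         (type_III W \<longrightarrow> int d \<le> 3 * \<lfloor>(real n - 6) / 12\<rfloor> + 3) \<and>
         (type_IV W \<longrightarrow> int d \<le> 2 * \<lfloor>(real n - 3) / 6\<rfloor> + 2)"
proof (intro conjI impI)
  assume "type_I W"
  hence W: "W \<in> gen_ring (W2 2) phi4" and anti: "formal_weight_enumerator 2 W"
    by (simp_all add: type_I_def)
  \<comment> \<open>With \<open>t = y^2\<close>:
    \<open>(1 + t)^4 - (1 - 6t + t^2)^2 = 16 t (1 - t)^2\<close>.\<close>
  have "int d \<le> int 2 * \<lfloor>(real n - real 4) / real (2 * 4)\<rfloor> + int 2"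
    by (rule minimum_distance_bound[OF assms W ev_homogeneous(1,2)
        formal_weight_enumerator_anti_invariant[OF anti] macwilliams_2(1,2),
        of "[:1, 1:]" 2 "[:1, -6, 1:]" 4 16])
      (simp_all add: W2_def phi4_def pderiv_pCons power2_eq_square algebra_simps eval_nat_numeral
        coeff_pCons_Nats split: nat.split)
  thus "int d \<le> 2 * \<lfloor>(real n - 4) / 8\<rfloor> + 2" by simp
next
  assume "type_II W"
  hence W: "W \<in> gen_ring WH8 W12" and anti: "formal_weight_enumerator 2 W"
    by (simp_all add: type_II_def)
  \<comment> \<open>With \<open>t = y^4\<close>: \<open>(1 + 14t + t^2)^3 - (1 - 33t - 33t^2 +
    t^3)^2 = 108 t (1 - t)^4\<close>.\<close>
  have "int d \<le> int 4 * \<lfloor>(real n - real 12) / real (2 * 12)\<rfloor> + int 4"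
    by (rule minimum_distance_bound[OF assms W ev_homogeneous(3,4)
        formal_weight_enumerator_anti_invariant[OF anti] macwilliams_2(3,4),
        of "[:1, 14, 1:]" 4 "[:1, -33, -33, 1:]" 3 108])
      (simp_all add: WH8_def W12_def pderiv_pCons power2_eq_square algebra_simps eval_nat_numeral
        coeff_pCons_Nats split: nat.split)
  thus "int d \<le> 4 * \<lfloor>(real n - 12) / 24\<rfloor> + 4" by simp
next
  assume "type_III W"
  hence W: "W \<in> gen_ring W4 psi6" and anti: "formal_weight_enumerator 3 W"
    by (simp_all add: type_III_def)
  \<comment> \<open>With \<open>t = y^3\<close>:
    \<open>(1 + 8t)^3 - (1 - 20t - 8t^2)^2 = 64 t (1 - t)^3\<close>.\<close>
  have "int d \<le> int 3 * \<lfloor>(real n - real 6) / real (2 * 6)\<rfloor> + int 3"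
    by (rule minimum_distance_bound[OF assms W ev_homogeneous(5,6)
        formal_weight_enumerator_anti_invariant[OF anti] macwilliams_3,
        of "[:1, 8:]" 3 "[:1, -20, -8:]" 3 64])
      (simp_all add: W4_def psi6_def pderiv_pCons power2_eq_square algebra_simps eval_nat_numeral
        coeff_pCons_Nats split: nat.split)
  thus "int d \<le> 3 * \<lfloor>(real n - 6) / 12\<rfloor> + 3" by simp
next
  assume "type_IV W"
  hence W: "W \<in> gen_ring (W2 4) phi3" and anti: "formal_weight_enumerator 4 W"
    by (simp_all add: type_IV_def)
  \<comment> \<open>With \<open>t = y^2\<close>:
    \<open>(1 + 3t)^3 - (1 - 9t)^2 = 27 t (1 - t)^2\<close>.\<close>
  have "int d \<le> int 2 * \<lfloor>(real n - real 3) / real (2 * 3)\<rfloor> + int 2"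
    by (rule minimum_distance_bound[OF assms W ev_homogeneous(1,7)
        formal_weight_enumerator_anti_invariant[OF anti] macwilliams_4,
        of "[:1, 3:]" 2 "[:1, -9:]" 3 27])
      (simp_all add: W2_def phi3_def pderiv_pCons power2_eq_square algebra_simps eval_nat_numeral
        coeff_pCons_Nats split: nat.split)
  thus "int d \<le> 2 * \<lfloor>(real n - 3) / 6\<rfloor> + 2" by simp
qed

end
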